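(* (I) Let $K\subset\mathbb{R}^\ell$ and $H\subset\mathbb{R}^m$ be convex bodies, let $n=\ell+m$, and let $\phi:\mathcal{K}^{n}\to\mathbb{R}$ be a valuation which is invariant with respect to the group of isometries of the Euclidean space $\mathbb{R}^n$. Then $g_{K\times H,\phi}=g_{K\times(-H),\phi}$. (II) For every $n\ge4$ and every valuation $\phi:\mathcal{K}^n\to\mathbb{R}$ invariant with respect to the group of isometries of the Euclidean space $\mathbb{R}^n$, there are pairs of convex bodies in $\mathbb{R}^n$ with equal $\phi$-covariogram which are not a translation or reflection of each other.
   Context: $\mathcal{K}^n$ is the set of all compact convex subsets of $\mathbb{R}^n$ (including $\emptyset$); a convex body in $\mathbb{R}^n$ is an element of $\mathcal{K}^n$ with nonempty interior. A valuation is a functional $\phi:\mathcal{K}^n\to\mathbb{R}$ with $\phi(\emptyset)=0$ and $\phi(K\cup H)=\phi(K)+\phi(H)-\phi(K\cap H)$ whenever $K,H,K\cup H\in\mathcal{K}^n$. For a convex body $K\subset\mathbb{R}^n$, the $\phi$-covariogram is $g_{K,\phi}(x)=\phi(K\cap(K+x))$, $x\in\mathbb{R}^n$. $\mathbb{R}^\ell\times\mathbb{R}^m$ is identified with $\mathbb{R}^{\ell+m}$. Reflection means reflection at a point. *)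

theory Defs
  imports "HOL-Analysis.Analysis"
begin

definition convex_sets :: "(real ^ 'n) set set" where
  "convex_sets = {K. compact K \<and> convex K}"

definition convex_body :: "(real ^ 'n) set \<Rightarrow> bool" where
  "convex_body K \<longleftrightarrow> K \<in> convex_sets \<and> interior K \<noteq> {}"

text \<open>A functional on the compact convex sets is represented by a function on all sets;
  its values outside \<^const>\<open>convex_sets\<close> are unconstrained.\<close>

definition valuation :: "((real ^ 'n) set \<Rightarrow> real) \<Rightarrow> bool" where
  "valuation \<phi> \<longleftrightarrow>
     \<phi> {} = 0 \<and>
     (\<forall>K H. K \<in> convex_sets \<and> H \<in> convex_sets \<and> K \<union> H \<in> convex_sets \<longrightarrow>
        \<phi> (K \<union> H) = \<phi> K + \<phi> H - \<phi> (K \<inter> H))"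

definition isometries :: "(real ^ 'n \<Rightarrow> real ^ 'n) set" where
  "isometries = {T. bij T \<and> (\<forall>x y. dist (T x) (T y) = dist x y)}"

definition isometry_invariant :: "((real ^ 'n) set \<Rightarrow> real) \<Rightarrow> bool" where
  "isometry_invariant \<phi> \<longleftrightarrow> (\<forall>T \<in> isometries. \<forall>K \<in> convex_sets. \<phi> (T ` K) = \<phi> K)"

definition covariogram :: "(real ^ 'n) set \<Rightarrow> ((real ^ 'n) set \<Rightarrow> real) \<Rightarrow> real ^ 'n \<Rightarrow> real" where
  "covariogram K \<phi> x = \<phi> (K \<inter> (\<lambda>y. y + x) ` K)"

text \<open>The identification of \<open>\<real>\<^sup>l \<times> \<real>\<^sup>m\<close> with \<open>\<real>\<^sup>l\<^sup>+\<^sup>m\<close>: the index type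
  of the concatenated vectors is the disjoint sum of the two index types, which has
  \<open>l + m\<close> elements.\<close>

definition join_vec :: "real ^ 'l \<Rightarrow> real ^ 'm \<Rightarrow> real ^ ('l + 'm)" where
  "join_vec x y = (\<chi> i. case i of Inl j \<Rightarrow> x $ j | Inr k \<Rightarrow> y $ k)"

definition prod_body :: "(real ^ 'l) set \<Rightarrow> (real ^ 'm) set \<Rightarrow> (real ^ ('l + 'm)) set" where
  "prod_body K H = (\<lambda>(x, y). join_vec x y) ` (K \<times> H)"

definition is_translation_of :: "(real ^ 'n) set \<Rightarrow> (real ^ 'n) set \<Rightarrow> bool" where
  "is_translation_of A B \<longleftrightarrow> (\<exists>v. A = (\<lambda>x. x + v) ` B)"

text \<open>Reflection at the point \<open>p\<close> is the map \<open>x \<mapsto> 2p - x\<close>.\<close>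

definition is_reflection_of :: "(real ^ 'n) set \<Rightarrow> (real ^ 'n) set \<Rightarrow> bool" where
  "is_reflection_of A B \<longleftrightarrow> (\<exists>p. A = (\<lambda>x. 2 *\<^sub>R p - x) ` B)"

end

theory Submission
  imports Defs
begin

text \<open>Let \<open>A\<close> be a product with respect to the splitting of the coordinates into \<open>S\<close> and its
  complement, and let \<open>A'\<close> be \<open>A\<close> with the coordinates outside \<open>S\<close> negated. Both
  \<open>A \<inter> (A + x)\<close> and \<open>A' \<inter> (A' + x)\<close> are again products, and the map which fixes the coordinates
  in \<open>S\<close> and sends \<open>z\<^sub>i\<close> to \<open>x\<^sub>i - z\<^sub>i\<close> outside \<open>S\<close> is an isometry carrying one onto the other; this
  is (I). For (II), take for \<open>A\<close> a product of two simplices of dimension at least 2.\<close>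

section \<open>Flips and mixing of coordinate blocks, and their effect on the covariogram\<close>

text \<open>One family covers both maps of the argument: \<open>x = 0\<close> negates the
  coordinates outside \<open>S\<close>, and a general \<open>x\<close> reflects them at
  \<open>x / 2\<close>.\<close>

definition flip_off :: "'n set \<Rightarrow> real ^ 'n \<Rightarrow> real ^ 'n \<Rightarrow> real ^ 'n" where
  "flip_off S x z = (\<chi> i. if i \<in> S then z $ i else x $ i - z $ i)"

text \<open>Closure of a set under \<open>mix_vec S\<close> encodes that it is a product with
  respect to \<open>S\<close> and its complement, without splitting the index type.\<close>

definition mix_vec :: "'n set \<Rightarrow> real ^ 'n \<Rightarrow> real ^ 'n \<Rightarrow> real ^ 'n" where
  "mix_vec S z w = (\<chi> i. if i \<in> S then z $ i else w $ i)"

lemma flip_off_nth [simp]: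
  "flip_off S x z $ i = (if i \<in> S then z $ i else x $ i - z $ i)"
  by (simp add: flip_off_def)

lemma mix_vec_nth [simp]: "mix_vec S z w $ i = (if i \<in> S then z $ i else w $ i)"
  by (simp add: mix_vec_def)

lemma flip_off_flip_off [simp]: "flip_off S x (flip_off S x z) = z"
  by (simp add: vec_eq_iff)

lemma mem_flip_off_image: "z \<in> flip_off S x ` A \<longleftrightarrow> flip_off S x z \<in> A"
  by (metis flip_off_flip_off imageE image_eqI)

lemma bij_flip_off: "bij (flip_off S x)"
  by (rule involuntory_imp_bij) simp

lemma flip_off_isometry: "flip_off S x \<in> isometries"
proof -
  have "dist (flip_off S x z) (flip_off S x w) = dist z w" for z w
  proof -
    have "dist (flip_off S x z $ i) (flip_off S x w $ i) = dist (z $ i) (w $ i)" for i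
      by (simp add: dist_real_def abs_minus_commute)
    then show ?thesis by (simp add: dist_vec_def)
  qed
  then show ?thesis by (simp add: isometries_def bij_flip_off)
qed

lemma linear_flip_off: "linear (flip_off S 0)"
  by (rule linearI) (simp_all add: vec_eq_iff)

lemma translate_convex_sets:
  fixes K :: "(real ^ 'n) set"
  assumes "K \<in> convex_sets"
  shows "(\<lambda>y. y + x) ` K \<in> convex_sets"
  using assms compact_translation[of K x] convex_translation[of K x]
  by (simp add: convex_sets_def add.commute)

lemma convex_sets_Int: "K \<in> convex_sets \<Longrightarrow> H \<in> convex_sets \<Longrightarrow> K \<inter> H \<in> convex_sets"
  by (simp add: convex_sets_def compact_Int convex_Int)

lemma mem_translate: "z \<in> (\<lambda>y. y + x) ` A \<longleftrightarrow> z - x \<in> A" for x :: "'a::ab_group_add"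
  by (auto intro: image_eqI[of _ _ "z - x"])

lemma covariogram_flip_off:
  fixes A :: "(real ^ 'n) set"
  assumes A: "A \<in> convex_sets" and inv: "isometry_invariant \<phi>"
    and mix: "\<And>z w. z \<in> A \<Longrightarrow> w \<in> A \<Longrightarrow> mix_vec S z w \<in> A"
  shows "covariogram (flip_off S 0 ` A) \<phi> = covariogram A \<phi>"
proof
  fix x
  have "w \<in> flip_off S 0 ` A \<inter> (\<lambda>y. y + x) ` flip_off S 0 ` A \<longleftrightarrow>
        w \<in> flip_off S x ` (A \<inter> (\<lambda>y. y + x) ` A)" for w
  proof -
    let ?z = "flip_off S x w" and ?a = "flip_off S 0 w" and ?b = "flip_off S 0 (w - x)"
    \<comment> \<open>Membership of \<open>w\<close> on the left is decided by \<open>?a\<close> and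
      \<open>?b\<close>, on the right by \<open>?z\<close> and \<open>?z - x\<close>. The two pairs
      agree in the coordinates in \<open>S\<close> and are swapped outside \<open>S\<close>, so
      mixing turns either pair into the other.\<close>
    have "?a = mix_vec S ?z (?z - x)" "?b = mix_vec S (?z - x) ?z"
      "?z = mix_vec S ?a ?b" "?z - x = mix_vec S ?b ?a"
      by (auto simp: vec_eq_iff)
    then have "?a \<in> A \<and> ?b \<in> A \<longleftrightarrow> ?z \<in> A \<and> ?z - x \<in> A"
      using mix by metis
    then show ?thesis
      by (simp only: Int_iff mem_flip_off_image mem_translate)
  qed
  then have "flip_off S 0 ` A \<inter> (\<lambda>y. y + x) ` flip_off S 0 ` A =
      flip_off S x ` (A \<inter> (\<lambda>y. y + x) ` A)"
    by blast
  \<comment> \<open>Invariance speaks only of compact convex sets, so the intersection has to be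
    one.\<close>
  then show "covariogram (flip_off S 0 ` A) \<phi> x = covariogram A \<phi> x"
    using inv flip_off_isometry[of S x] convex_sets_Int[OF A translate_convex_sets[OF A]]
    unfolding covariogram_def isometry_invariant_def by simp
qed

section \<open>Products in the space indexed by a disjoint sum\<close>

lemma join_vec_nth [simp]:
  "join_vec x y $ Inl j = x $ j" "join_vec x y $ Inr k = y $ k"
  by (simp_all add: join_vec_def)

lemma vec_sum_eq_iff:
  fixes z w :: "'a ^ ('l::finite + 'm::finite)"
  shows "z = w \<longleftrightarrow> (\<forall>j. z $ Inl j = w $ Inl j) \<and> (\<forall>k. z $ Inr k = w $ Inr k)"
  unfolding vec_eq_iff by (rule split_sum_all)

lemma linear_join_vec: "linear (\<lambda>(x, y). join_vec x y)"
  by (rule linearI) (auto simp: vec_sum_eq_iff)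

lemma prod_body_convex_sets:
  assumes "K \<in> convex_sets" "H \<in> convex_sets"
  shows "prod_body K H \<in> convex_sets"
  using assms unfolding convex_sets_def prod_body_def
  by (simp add: compact_Times convex_Times convex_linear_image linear_join_vec
      compact_continuous_image linear_continuous_on linear_linear)

text \<open>Supplies the mixing hypothesis of \<open>covariogram_flip_off\<close> for
  \<open>S = range Inl\<close>: the first factor comes from \<open>z\<close>, the second from
  \<open>w\<close>.\<close>

lemma mix_vec_prod_body:
  assumes "z \<in> prod_body K H" "w \<in> prod_body K H"
  shows "mix_vec (range Inl) z w \<in> prod_body K H"
proof -
  obtain a b c d where "a \<in> K" "d \<in> H" and "z = join_vec a b" "w = join_vec c d"
    using assms by (auto simp: prod_body_def)
  moreover from this have "mix_vec (range Inl) z w = join_vec a d"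
    by (auto simp: vec_sum_eq_iff)
  ultimately show ?thesis by (auto simp: prod_body_def)
qed

text \<open>Turns the second body of (I) into a flip of the first, so that
  \<open>covariogram_flip_off\<close> applies.\<close>

lemma prod_body_uminus:
  fixes K :: "(real ^ 'l) set" and H :: "(real ^ 'm) set"
  shows "prod_body K (uminus ` H) = flip_off (range Inl) 0 ` prod_body K H"
proof -
  have "flip_off (range Inl) 0 (join_vec x y) = join_vec x (- y)"
    for x :: "real ^ 'l" and y :: "real ^ 'm"
    by (auto simp: vec_sum_eq_iff)
  then have "flip_off (range Inl) 0 ` prod_body K H = (\<lambda>(x, y). join_vec x (- y)) ` (K \<times> H)"
    by (simp add: prod_body_def image_image case_prod_beta)
  also have "\<dots> = (\<lambda>(x, y). join_vec x y) ` map_prod id uminus ` (K \<times> H)"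
    by (simp add: image_image case_prod_beta)
  also have "\<dots> = prod_body K (uminus ` H)"
    by (simp add: prod_body_def map_prod_surj_on)
  finally show ?thesis ..
qed

section \<open>The product of two simplices as an example for (II)\<close>

text \<open>The product of the standard simplices (origin and unit vectors as vertices) in the
  blocks \<open>S\<close> and \<open>-S\<close>. Inequalities are used because the index type in
  (II) is arbitrary and need not be a sum.\<close>

definition simplex_prod :: "'n set \<Rightarrow> (real ^ 'n) set" where
  "simplex_prod S =
     {z. (\<forall>i. 0 \<le> z $ i) \<and> (\<Sum>i\<in>S. z $ i) \<le> 1 \<and> (\<Sum>i\<in>-S. z $ i) \<le> 1}"

text \<open>Used for boundedness. As all coordinates are nonnegative, each is at most the sum over
  its own block.\<close>

lemma simplex_prod_le_1:
  fixes S :: "'n::finite set"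
  assumes "z \<in> simplex_prod S"
  shows "z $ i \<le> 1"
proof -
  have "z $ i \<le> (\<Sum>j\<in>T. z $ j)" if "i \<in> T" for T
    using assms that by (intro member_le_sum) (auto simp: simplex_prod_def)
  from this[of S] this[of "- S"] show ?thesis
    using assms by (cases "i \<in> S") (auto simp: simplex_prod_def)
qed

lemma convex_body_simplex_prod: "convex_body (simplex_prod S :: (real ^ 'n) set)"
proof -
  have "closed (simplex_prod S)"
    unfolding simplex_prod_def
    by (intro closed_Collect_conj closed_Collect_all closed_Collect_le continuous_intros)
  moreover have "simplex_prod S \<subseteq> cbox 0 1"
    using simplex_prod_le_1[of _ S] by (auto simp: mem_box_cart simplex_prod_def)
  then have "bounded (simplex_prod S)"
    using bounded_cbox bounded_subset by blast
  moreover have "convex (simplex_prod S)"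
  proof (rule convexI)
    fix z w :: "real ^ 'n" and u v :: real
    assume *: "z \<in> simplex_prod S" "w \<in> simplex_prod S" "0 \<le> u" "0 \<le> v" "u + v = 1"
    have "(\<Sum>i\<in>T. (u *\<^sub>R z + v *\<^sub>R w) $ i) \<le> 1"
      if "(\<Sum>i\<in>T. z $ i) \<le> 1" "(\<Sum>i\<in>T. w $ i) \<le> 1" for T
      using * that convex_bound_le[of "\<Sum>i\<in>T. z $ i" 1 "\<Sum>i\<in>T. w $ i" u v]
      by (simp add: sum.distrib flip: sum_distrib_left)
    with * show "u *\<^sub>R z + v *\<^sub>R w \<in> simplex_prod S"
      by (simp add: simplex_prod_def)
  qed
  moreover have "interior (simplex_prod S) \<noteq> {}"
  proof -
    \<comment> \<open>With n coordinates between 0 and 1/n, every partial sum is at most 1, so the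
      open box below \<open>e\<close> lies in the body.\<close>
    define e :: "real ^ 'n" where "e = (\<chi> i. 1 / real CARD('n))"
    have "box 0 e \<subseteq> simplex_prod S"
    proof
      fix z assume "z \<in> box 0 e"
      then have z: "0 < z $ i" "z $ i < 1 / real CARD('n)" for i
        by (auto simp: mem_box_cart e_def)
      have "(\<Sum>i\<in>T. z $ i) \<le> 1" for T
      proof -
        have "(\<Sum>i\<in>T. z $ i) \<le> (\<Sum>i\<in>UNIV. z $ i)"
          using z(1) by (intro sum_mono2) (auto intro: less_imp_le)
        also have "\<dots> \<le> (\<Sum>i\<in>(UNIV :: 'n set). 1 / real CARD('n))"
          using z(2) by (intro sum_mono less_imp_le)
        finally show ?thesis by simp
      qed
      then show "z \<in> simplex_prod S"
        using z(1) by (simp add: simplex_prod_def less_imp_le)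
    qed
    moreover have "box 0 e \<noteq> {}"
      by (simp add: interval_ne_empty_cart e_def)
    ultimately show ?thesis
      using interior_maximal[OF _ open_box] by blast
  qed
  ultimately show ?thesis
    by (simp add: convex_body_def convex_sets_def compact_eq_bounded_closed)
qed

lemma convex_body_flip_off:
  fixes A :: "(real ^ 'n) set"
  assumes "convex_body A"
  shows "convex_body (flip_off S 0 ` A)"
  using assms linear_flip_off[of S] bij_flip_off[of S 0]
  unfolding convex_body_def convex_sets_def
  by (simp add: convex_linear_image compact_continuous_image linear_continuous_on linear_linear
      interior_bijective_linear_image)

text \<open>Each defining inequality involves a single block, and mixing takes each block entirely
  from one point.\<close>

lemma mix_vec_simplex_prod:
  fixes S :: "'n::finite set"
  assumes "z \<in> simplex_prod S" "w \<in> simplex_prod S"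
  shows "mix_vec S z w \<in> simplex_prod S"
proof -
  have "(\<Sum>i\<in>S. mix_vec S z w $ i) = (\<Sum>i\<in>S. z $ i)"
    "(\<Sum>i\<in>-S. mix_vec S z w $ i) = (\<Sum>i\<in>-S. w $ i)"
    by (auto intro: sum.cong)
  with assms show ?thesis
    by (auto simp: simplex_prod_def)
qed

lemma axis_in_simplex_prod: "axis i 1 \<in> simplex_prod S" for S :: "'n::finite set"
  by (auto simp: simplex_prod_def axis_def)

lemma zero_in_simplex_prod: "0 \<in> simplex_prod S" for S :: "'n::finite set"
  by (simp add: simplex_prod_def)

text \<open>Outside \<open>S\<close>, \<open>flip_off S 0 (z - v)\<close> is \<open>v - z\<close>,
  so a translation would make the simplex in that block centrally symmetric. This fails from
  dimension 2 on; a segment is symmetric.\<close>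

lemma simplex_prod_not_translation:
  fixes S :: "'n::finite set"
  assumes "card (- S) \<ge> 2"
  shows "\<not> is_translation_of (simplex_prod S) (flip_off S 0 ` simplex_prod S)"
proof
  assume "is_translation_of (simplex_prod S) (flip_off S 0 ` simplex_prod S)"
  then obtain v where "simplex_prod S = (\<lambda>x. x + v) ` flip_off S 0 ` simplex_prod S"
    unfolding is_translation_of_def by blast
  then have v: "flip_off S 0 (z - v) \<in> simplex_prod S" if "z \<in> simplex_prod S" for z
    using that by (metis mem_flip_off_image mem_translate)
  \<comment> \<open>Each vertex \<open>axis i 1\<close> forces \<open>v $ i\<close> to be at least
    1, while the origin bounds the sum of these coordinates by 1.\<close>
  have "1 \<le> v $ i" if "i \<in> - S" for i
  proof -
    have "0 \<le> flip_off S 0 (axis i 1 - v) $ i"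
      using v[OF axis_in_simplex_prod] unfolding simplex_prod_def by blast
    with that show ?thesis by (simp add: axis_def)
  qed
  then have "(\<Sum>i\<in>-S. v $ i) \<ge> real (card (- S))"
    using sum_mono[of "- S" "\<lambda>_. 1" "\<lambda>i. v $ i"] by simp
  moreover have "(\<Sum>i\<in>-S. v $ i) \<le> 1"
    using v[OF zero_in_simplex_prod] by (simp add: simplex_prod_def)
  ultimately show False using assms by simp
qed

text \<open>A point reflection undoes the negation outside \<open>S\<close> up to a shift, but
  negates the block \<open>S\<close>; now the simplex in \<open>S\<close> would have to be centrally
  symmetric.\<close>

lemma simplex_prod_not_reflection:
  fixes S :: "'n::finite set"
  assumes "card S \<ge> 2"
  shows "\<not> is_reflection_of (simplex_prod S) (flip_off S 0 ` simplex_prod S)"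
proof
  assume "is_reflection_of (simplex_prod S) (flip_off S 0 ` simplex_prod S)"
  then obtain p where p: "simplex_prod S = (\<lambda>x. 2 *\<^sub>R p - x) ` flip_off S 0 ` simplex_prod S"
    unfolding is_reflection_of_def by blast
  define v where "v = 2 *\<^sub>R p"
  have v: "flip_off S 0 (v - z) \<in> simplex_prod S" if "z \<in> simplex_prod S" for z
  proof -
    obtain x where "z = v - x" "x \<in> flip_off S 0 ` simplex_prod S"
      using \<open>z \<in> simplex_prod S\<close> p unfolding v_def by blast
    then show ?thesis by (simp add: mem_flip_off_image)
  qed
  have "1 \<le> v $ i" if "i \<in> S" for i
  proof -
    have "0 \<le> flip_off S 0 (v - axis i 1) $ i"
      using v[OF axis_in_simplex_prod] unfolding simplex_prod_def by blast
    with that show ?thesis by (simp add: axis_def)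
  qed
  then have "(\<Sum>i\<in>S. v $ i) \<ge> real (card S)"
    using sum_mono[of S "\<lambda>_. 1" "\<lambda>i. v $ i"] by simp
  moreover have "(\<Sum>i\<in>S. v $ i) \<le> 1"
    using v[OF zero_in_simplex_prod] by (simp add: simplex_prod_def)
  ultimately show False using assms by simp
qed

theorem theorem5p9:
  shows
    "(\<forall>(K :: (real ^ 'l) set) (H :: (real ^ 'm) set) (\<phi> :: (real ^ ('l + 'm)) set \<Rightarrow> real).
        convex_body K \<and> convex_body H \<and> valuation \<phi> \<and> isometry_invariant \<phi> \<longrightarrow>
        covariogram (prod_body K H) \<phi> = covariogram (prod_body K (uminus ` H)) \<phi>)
     \<and>
     (CARD('n) \<ge> 4 \<longrightarrow>
        (\<forall>\<phi> :: (real ^ 'n) set \<Rightarrow> real.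
           valuation \<phi> \<and> isometry_invariant \<phi> \<longrightarrow>
           (\<exists>A B. convex_body A \<and> convex_body B \<and>
              covariogram A \<phi> = covariogram B \<phi> \<and>
              \<not> is_translation_of A B \<and> \<not> is_reflection_of A B)))"
proof (intro conjI allI impI)
  fix K :: "(real ^ 'l) set" and H :: "(real ^ 'm) set"
    and \<phi> :: "(real ^ ('l + 'm)) set \<Rightarrow> real"
  assume "convex_body K \<and> convex_body H \<and> valuation \<phi> \<and> isometry_invariant \<phi>"
  then show "covariogram (prod_body K H) \<phi> = covariogram (prod_body K (uminus ` H)) \<phi>"
    by (simp add: prod_body_uminus covariogram_flip_off prod_body_convex_sets
        mix_vec_prod_body convex_body_def)
next
  fix \<phi> :: "(real ^ 'n) set \<Rightarrow> real"
  assume "CARD('n) \<ge> 4" and \<phi>: "valuation \<phi> \<and> isometry_invariant \<phi>"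
  \<comment> \<open>Two indices in \<open>S\<close> leave at least two outside, so both blocks carry
    a simplex without central symmetry.\<close>
  then obtain S :: "'n set" where S: "card S = 2"
    using obtain_subset_with_card_n[of 2 "UNIV :: 'n set"] by auto
  with \<open>CARD('n) \<ge> 4\<close> have S': "card (- S) \<ge> 2"
    by (simp add: Compl_eq_Diff_UNIV card_Diff_subset)
  let ?A = "simplex_prod S"
  have "covariogram ?A \<phi> = covariogram (flip_off S 0 ` ?A) \<phi>"
    using \<phi> convex_body_simplex_prod[of S]
    by (simp add: covariogram_flip_off mix_vec_simplex_prod convex_body_def)
  then show "\<exists>A B. convex_body A \<and> convex_body B \<and> covariogram A \<phi> = covariogram B \<phi> \<and>
      \<not> is_translation_of A B \<and> \<not> is_reflection_of A B"
    using convex_body_simplex_prod[of S] convex_body_flip_off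
      simplex_prod_not_translation[OF S'] simplex_prod_not_reflection[of S] S by auto
qed

end
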